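(* Let $(X,d)$ be an $m$-space with $X$ finite and let $P_1,P_2$ be nonempty subsets of $X$. For $k\in\{1,2\}$ and nonempty $A\subseteq X$ let $T_k(A)=\mathrm{dom}(P_k,A)$, and let $g_1=T_1\circ T_2$ and $g_2=T_2\circ T_1$. Then there are nonnegative integers $n_1,N_1\le |X|-|P_1|$ and $n_2,N_2\le |X|-|P_2|$ such that $$R=\big(g_1^{n_1}(P_1),\,T_2(g_1^{n_1}(P_1))\big),\qquad S=\big(g_1^{N_1}(X),\,T_2(g_1^{N_1}(X))\big),$$ $$Z=\big(T_1(g_2^{n_2}(P_2)),\,g_2^{n_2}(P_2)\big),\qquad W=\big(T_1(g_2^{N_2}(X)),\,g_2^{N_2}(X)\big)$$ are all zone diagrams in $X$ with respect to $(P_1,P_2)$.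
   Context: An $m$-space is a pair $(X,d)$ of a nonempty set $X$ and a function $d:X^2\to[-\infty,\infty]$ such that $d(x,x)\le d(x,y)$ for all $x,y\in X$ (no symmetry, positivity or triangle inequality is assumed). For $x\in X$ and a nonempty $A\subseteq X$, $d(x,A)=\inf\{d(x,y):y\in A\}$. For nonempty $P,A\subseteq X$, $\mathrm{dom}(P,A)=\{x\in X: d(x,P)\le d(x,A)\}$; it contains $P$, hence is nonempty. A zone diagram with respect to $(P_1,P_2)$ is a pair $(R_1,R_2)$ of nonempty subsets of $X$ with $R_1=\mathrm{dom}(P_1,R_2)$ and $R_2=\mathrm{dom}(P_2,R_1)$. $g^{n}$ denotes the $n$-th iterate of $g$ ($g^0$ is the identity), and $|\cdot|$ denotes cardinality. *)

theory Defs
  imports "HOL-Library.Extended_Real"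
begin

definition m_space :: "'a set \<Rightarrow> ('a \<Rightarrow> 'a \<Rightarrow> ereal) \<Rightarrow> bool" where
  "m_space X d \<longleftrightarrow> X \<noteq> {} \<and> (\<forall>x\<in>X. \<forall>y\<in>X. d x x \<le> d x y)"

definition set_dist :: "('a \<Rightarrow> 'a \<Rightarrow> ereal) \<Rightarrow> 'a \<Rightarrow> 'a set \<Rightarrow> ereal" where
  "set_dist d x A = (INF y\<in>A. d x y)"

text \<open>Total in \<open>P\<close> and \<open>A\<close>, but meaningful only for nonempty subsets of \<open>X\<close>.
  The name \<open>dom\<close> is avoided because it denotes the domain of a map in Main.\<close>

definition dominance :: "'a set \<Rightarrow> ('a \<Rightarrow> 'a \<Rightarrow> ereal) \<Rightarrow> 'a set \<Rightarrow> 'a set \<Rightarrow> 'a set" where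
  "dominance X d P A = {x \<in> X. set_dist d x P \<le> set_dist d x A}"

definition zone_diagram ::
  "'a set \<Rightarrow> ('a \<Rightarrow> 'a \<Rightarrow> ereal) \<Rightarrow> 'a set \<times> 'a set \<Rightarrow> 'a set \<times> 'a set \<Rightarrow> bool" where
  "zone_diagram X d P R \<longleftrightarrow>
     fst R \<subseteq> X \<and> fst R \<noteq> {} \<and> snd R \<subseteq> X \<and> snd R \<noteq> {} \<and>
     fst R = dominance X d (fst P) (snd R) \<and>
     snd R = dominance X d (snd P) (fst R)"

end

theory Submission
  imports Defs
begin

text \<open>
  The dominance operator reverses inclusions in its second argument, so \<open>g1\<close> and \<open>g2\<close> are
  monotone. It always returns a subset of \<open>X\<close>, and, because \<open>d x x \<le> d x y\<close>, that subset
  contains the site set. Hence the iterates of \<open>g1\<close> form an increasing chain when started at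
  \<open>P1\<close> and a decreasing chain when started at \<open>X\<close>, and both chains stay between \<open>P1\<close> and \<open>X\<close>.
  Such a chain has at most \<open>card X - card P1\<close> strict steps, so two consecutive members agree
  by then (lemmas \<open>increasing_chain_stalls\<close> and \<open>decreasing_chain_stalls\<close>). The earlier of the
  two is a fixed point of \<open>g1 = T1 \<circ> T2\<close>, which is the same as the first component of a zone
  diagram (lemma \<open>zone_diagram_of_fixed_point\<close>). The statements for \<open>g2\<close> follow by exchanging
  the roles of the two site sets.
\<close>

lemma increasing_chain_stalls:
  fixes A :: "nat \<Rightarrow> 'a set"
  assumes "finite Y" and "\<And>n. L \<subseteq> A n" and "\<And>n. A n \<subseteq> Y" and "\<And>n. A n \<subseteq> A (Suc n)"
  shows "\<exists>n \<le> card Y - card L. A (Suc n) = A n"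
proof (rule ccontr)
  assume contra: "\<not> ?thesis"
  have fin: "finite (A n)" for n
    using assms(1,3) finite_subset by blast
  have growth: "n \<le> Suc (card Y - card L) \<Longrightarrow> card L + n \<le> card (A n)" for n
  proof (induction n)
    case 0
    show ?case using card_mono[OF fin assms(2)] by simp
  next
    case (Suc n)
    then have "A n \<subset> A (Suc n)" using contra assms(4)[of n] by auto
    then have "card (A n) < card (A (Suc n))" by (rule psubset_card_mono[OF fin])
    with Suc show ?case by simp
  qed
  have "card (A (Suc (card Y - card L))) \<le> card Y"
    using card_mono[OF assms(1,3)] .
  with growth[of "Suc (card Y - card L)"] show False by linarith
qed

lemma decreasing_chain_stalls:
  fixes A :: "nat \<Rightarrow> 'a set"
  assumes "finite Y" and "\<And>n. L \<subseteq> A n" and "\<And>n. A n \<subseteq> Y" and "\<And>n. A (Suc n) \<subseteq> A n"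
  shows "\<exists>n \<le> card Y - card L. A (Suc n) = A n"
proof -
  have "L \<subseteq> Y" using assms(2,3) by blast
  then have card: "card (Y - L) - card ({} :: 'a set) = card Y - card L"
    using assms(1) by (simp add: card_Diff_subset finite_subset)
  \<comment> \<open>The complements form an increasing chain between the empty set and \<open>Y - L\<close>.\<close>
  have "\<exists>n \<le> card (Y - L) - card ({} :: 'a set). Y - A (Suc n) = Y - A n"
    by (rule increasing_chain_stalls[where A = "\<lambda>n. Y - A n"]) (use assms in blast)+
  then show ?thesis unfolding card using assms(3) by (metis double_diff subset_refl)
qed

lemma dominance_antimono:
  assumes "A \<subseteq> B"
  shows "dominance X d P B \<subseteq> dominance X d P A"
proof -
  have "set_dist d x B \<le> set_dist d x A" for x
    unfolding set_dist_def by (rule INF_superset_mono[OF assms]) simp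
  then show ?thesis unfolding dominance_def using order_trans by blast
qed

lemma dominance_subset: "dominance X d P A \<subseteq> X"
  unfolding dominance_def by blast

lemma sites_subset_dominance:
  assumes "m_space X d" and "P \<subseteq> X" and "A \<subseteq> X"
  shows "P \<subseteq> dominance X d P A"
proof
  fix x assume "x \<in> P"
  have "set_dist d x P \<le> d x x"
    unfolding set_dist_def using \<open>x \<in> P\<close> by (rule INF_lower)
  also have "d x x \<le> set_dist d x A"
    unfolding set_dist_def using assms \<open>x \<in> P\<close>
    by (intro INF_greatest) (auto simp: m_space_def)
  finally show "x \<in> dominance X d P A"
    using \<open>x \<in> P\<close> assms(2) by (auto simp: dominance_def)
qed

lemma zone_diagram_swap:
  "zone_diagram X d (P, Q) (R, S) \<longleftrightarrow> zone_diagram X d (Q, P) (S, R)"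
  unfolding zone_diagram_def by auto

lemma zone_diagram_of_fixed_point:
  assumes "m_space X d" and "P \<subseteq> X" "P \<noteq> {}" and "Q \<subseteq> X" "Q \<noteq> {}"
    and fix_A: "dominance X d P (dominance X d Q A) = A"
  shows "zone_diagram X d (P, Q) (A, dominance X d Q A)"
proof -
  have "A \<subseteq> X" using fix_A dominance_subset by metis
  moreover have "P \<subseteq> A"
    using sites_subset_dominance[OF assms(1,2) dominance_subset] fix_A by metis
  moreover have "Q \<subseteq> dominance X d Q A"
    using sites_subset_dominance[OF assms(1,4) \<open>A \<subseteq> X\<close>] .
  ultimately show ?thesis
    using assms(3,5) fix_A dominance_subset[of X d Q A] by (auto simp: zone_diagram_def)
qed

text \<open>One half of the theorem; the other half is the instance with \<open>P\<close> and \<open>Q\<close> exchanged.\<close>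

lemma zone_diagram_iteration:
  fixes X :: "'a set" and d :: "'a \<Rightarrow> 'a \<Rightarrow> ereal" and P Q :: "'a set"
  assumes "m_space X d" and "finite X" and "P \<subseteq> X" "P \<noteq> {}" and "Q \<subseteq> X" "Q \<noteq> {}"
  defines "g \<equiv> dominance X d P \<circ> dominance X d Q"
  shows "\<exists>n \<le> card X - card P.
      zone_diagram X d (P, Q) ((g ^^ n) P, dominance X d Q ((g ^^ n) P))"
    and "\<exists>n \<le> card X - card P.
      zone_diagram X d (P, Q) ((g ^^ n) X, dominance X d Q ((g ^^ n) X))"
proof -
  have mono: "mono g"
    unfolding g_def by (simp add: monoI dominance_antimono)
  have g_X: "g A \<subseteq> X" for A
    unfolding g_def by (simp add: dominance_subset)
  have P_g: "P \<subseteq> g A" for A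
    unfolding g_def using sites_subset_dominance[OF assms(1,3) dominance_subset] by simp
  have below: "P \<subseteq> (g ^^ n) A" if "P \<subseteq> A" for n A
    using that P_g by (cases n) auto
  have above: "(g ^^ n) A \<subseteq> X" if "A \<subseteq> X" for n A
    using that g_X by (cases n) auto
  have zone: "zone_diagram X d (P, Q) (A, dominance X d Q A)" if "g A = A" for A
    using zone_diagram_of_fixed_point[OF assms(1,3-6)] that by (simp add: g_def)
  have "\<exists>n \<le> card X - card P. (g ^^ Suc n) P = (g ^^ n) P"
  proof (rule increasing_chain_stalls[OF assms(2)])
    show "(g ^^ n) P \<subseteq> (g ^^ Suc n) P" for n
      using funpow_mono[OF mono P_g[of P], of n] by (simp add: funpow_swap1)
  qed (use below above assms(3) in blast)+
  then show "\<exists>n \<le> card X - card P.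
      zone_diagram X d (P, Q) ((g ^^ n) P, dominance X d Q ((g ^^ n) P))"
    using zone by auto
  have "\<exists>n \<le> card X - card P. (g ^^ Suc n) X = (g ^^ n) X"
  proof (rule decreasing_chain_stalls[OF assms(2)])
    show "(g ^^ Suc n) X \<subseteq> (g ^^ n) X" for n
      using funpow_mono[OF mono g_X[of X], of n] by (simp add: funpow_swap1)
  qed (use below above assms(3) in blast)+
  then show "\<exists>n \<le> card X - card P.
      zone_diagram X d (P, Q) ((g ^^ n) X, dominance X d Q ((g ^^ n) X))"
    using zone by auto
qed

theorem theorem7p1:
  fixes X :: "'a set" and d :: "'a \<Rightarrow> 'a \<Rightarrow> ereal"
    and P1 P2 :: "'a set" and T1 T2 g1 g2 :: "'a set \<Rightarrow> 'a set"
  assumes "m_space X d" and "finite X"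
    and "P1 \<subseteq> X" and "P1 \<noteq> {}" and "P2 \<subseteq> X" and "P2 \<noteq> {}"
  defines "T1 \<equiv> dominance X d P1" and "T2 \<equiv> dominance X d P2"
  defines "g1 \<equiv> T1 \<circ> T2" and "g2 \<equiv> T2 \<circ> T1"
  shows "\<exists>n1 N1 n2 N2 :: nat.
    n1 \<le> card X - card P1 \<and> N1 \<le> card X - card P1 \<and>
    n2 \<le> card X - card P2 \<and> N2 \<le> card X - card P2 \<and>
    zone_diagram X d (P1, P2) ((g1 ^^ n1) P1, T2 ((g1 ^^ n1) P1)) \<and>
    zone_diagram X d (P1, P2) ((g1 ^^ N1) X, T2 ((g1 ^^ N1) X)) \<and>
    zone_diagram X d (P1, P2) (T1 ((g2 ^^ n2) P2), (g2 ^^ n2) P2) \<and>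
    zone_diagram X d (P1, P2) (T1 ((g2 ^^ N2) X), (g2 ^^ N2) X)"
proof -
  note half1 = zone_diagram_iteration[OF assms(1-6), folded T1_def T2_def, folded g1_def]
  note half2 = zone_diagram_iteration[OF assms(1,2,5,6,3,4), folded T1_def T2_def, folded g2_def]
  show ?thesis
    using half1 half2[unfolded zone_diagram_swap[of X d P2 P1]] by blast
qed

end
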